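(* For any signature $S$ and any $S$-term $t$, the set $\downarrow t:=\{t'\in T(S): t\preceq t'\}$ ordered by $\preceq$ is a lattice, and its join is the operation $\vee$ defined by: for $t_1,t_2\in\downarrow t$, $t_1\vee t_2$ is the $S$-term with decoration word $\mathrm{dc}(t)$ whose connection word is the componentwise maximum of $\mathrm{cnc}(t_1)$ and $\mathrm{cnc}(t_2)$ (such a term exists and lies in $\downarrow t$).
   Context: A signature is a set $S$ with an arity map $|\cdot|:S\to\mathbb N$. An $S$-term is either the leaf $\ell$ or $s\,t_1\cdots t_{|s|}$ with $s\in S$ and $S$-terms $t_i$; $T(S)$ is the set of $S$-terms. Preorder traversal: root, then subterms left to right recursively. Internal nodes of $t$ are numbered $1,\dots,\deg t$ in preorder; $\mathrm{dc}(t)$ is the word of their decorations. Children (leaves included) are numbered from $1$ left to right; the parent edge of internal node $i$ is $(\mathrm{pa}(i),\mathrm{lp}(i),i)$ where $i$ is the $\mathrm{lp}(i)$-th child of $\mathrm{pa}(i)$, with the convention $\mathrm{pa}(1)=1,\mathrm{lp}(1)=0$. Connection word: $\mathrm{cnc}(t)(i)=\mathrm{pa}(i)+1-2^{\mathrm{lp}(i)-a}$, $a$ the arity of the decoration of $\mathrm{pa}(i)$; a term is determined by its decoration word and connection word. Easterly wind order: $t_1\preceq t_2$ iff $\mathrm{dc}(t_1)=\mathrm{dc}(t_2)$ and $\mathrm{cnc}(t_1)(i)\le\mathrm{cnc}(t_2)(i)$ for all $i$. *)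

theory Defs
  imports Complex_Main "HOL-Algebra.Lattice"
begin

datatype 's tm = Leaf | Node 's "'s tm list"

inductive_set terms :: "'s set \<Rightarrow> ('s \<Rightarrow> nat) \<Rightarrow> 's tm set"
  for S :: "'s set" and ar :: "'s \<Rightarrow> nat" where
  Leaf: "Leaf \<in> terms S ar"
| Node: "s \<in> S \<Longrightarrow> length ts = ar s \<Longrightarrow> (\<forall>u\<in>set ts. u \<in> terms S ar)
    \<Longrightarrow> Node s ts \<in> terms S ar"

primrec dc :: "'s tm \<Rightarrow> 's list" where
  "dc Leaf = []"
| "dc (Node s ts) = s # concat (map dc ts)"

text \<open>The internal nodes in preorder, each given by its path from the root, that is, the list of
  the child numbers met on the way down. Children, leaves included, are numbered from 1.\<close>

primrec inodes :: "'s tm \<Rightarrow> nat list list" where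
  "inodes Leaf = []"
| "inodes (Node s ts) =
     [] # concat (map2 (\<lambda>j ps. map ((#) j) ps) [1..<Suc (length ts)] (map inodes ts))"

definition tdeg :: "'s tm \<Rightarrow> nat" where
  "tdeg t = length (inodes t)"

text \<open>Node numbers start at 1 and list indices at 0, hence the shift by one in \<open>inode\<close> and
  \<open>decoration\<close>. All functions of a node number \<open>i\<close> are meaningful
  for \<open>i \<in> {1..tdeg t}\<close> only.\<close>

definition inode :: "'s tm \<Rightarrow> nat \<Rightarrow> nat list" where
  "inode t i = inodes t ! (i - 1)"

definition decoration :: "'s tm \<Rightarrow> nat \<Rightarrow> 's" where
  "decoration t i = dc t ! (i - 1)"

definition pa :: "'s tm \<Rightarrow> nat \<Rightarrow> nat" where
  "pa t i = (if i = 1 then 1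
     else (THE p. p \<in> {1..tdeg t} \<and> (\<exists>j. inode t i = inode t p @ [j])))"

definition lp :: "'s tm \<Rightarrow> nat \<Rightarrow> nat" where
  "lp t i = (if i = 1 then 0 else (THE j. inode t i = inode t (pa t i) @ [j]))"

definition cnc :: "('s \<Rightarrow> nat) \<Rightarrow> 's tm \<Rightarrow> nat \<Rightarrow> real" where
  "cnc ar t i = real (pa t i) + 1
     - 2 powi (int (lp t i) - int (ar (decoration t (pa t i))))"

definition ew_le :: "('s \<Rightarrow> nat) \<Rightarrow> 's tm \<Rightarrow> 's tm \<Rightarrow> bool" where
  "ew_le ar t1 t2 \<longleftrightarrow> dc t1 = dc t2 \<and> (\<forall>i\<in>{1..tdeg t1}. cnc ar t1 i \<le> cnc ar t2 i)"

text \<open>The set \<open>\<down>t\<close> consists of the terms that are greater than or equal to \<open>t\<close>.\<close>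

definition down :: "'s set \<Rightarrow> ('s \<Rightarrow> nat) \<Rightarrow> 's tm \<Rightarrow> 's tm set" where
  "down S ar t = {t' \<in> terms S ar. ew_le ar t t'}"

definition down_order :: "'s set \<Rightarrow> ('s \<Rightarrow> nat) \<Rightarrow> 's tm \<Rightarrow> 's tm gorder" where
  "down_order S ar t = \<lparr>carrier = down S ar t, eq = (=), le = ew_le ar\<rparr>"

definition is_vee ::
  "'s set \<Rightarrow> ('s \<Rightarrow> nat) \<Rightarrow> 's tm \<Rightarrow> 's tm \<Rightarrow> 's tm \<Rightarrow> 's tm \<Rightarrow> bool" where
  "is_vee S ar t t1 t2 u \<longleftrightarrow> u \<in> terms S ar \<and> dc u = dc t
     \<and> (\<forall>i\<in>{1..tdeg t}. cnc ar u i = max (cnc ar t1 i) (cnc ar t2 i))"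

definition vee :: "'s set \<Rightarrow> ('s \<Rightarrow> nat) \<Rightarrow> 's tm \<Rightarrow> 's tm \<Rightarrow> 's tm \<Rightarrow> 's tm" where
  "vee S ar t t1 t2 = (THE u. is_vee S ar t t1 t2 u)"

end

theory Submission
  imports Defs
begin

text \<open>
  The letter of node \<open>i\<close> encodes the slot, child \<open>j\<close> of node \<open>p\<close>, into which \<open>i\<close> is plugged, and a
  larger letter means an earlier slot in preorder. Reading a decoration word from left to
  right, node \<open>i\<close> may be plugged into exactly those slots of earlier nodes \<open>p\<close> that have not been
  filled or skipped by any of the nodes \<open>p + 1, \<dots>, i - 1\<close>. Hence \<open>c\<close> is a connection word iff
  every letter \<open>c i\<close> is a slot of some \<open>p < i\<close> with \<open>c k > c i\<close> for all \<open>p < k < i\<close>. This condition is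
  inherited by componentwise maxima, which are therefore the joins. As only finitely many terms
  share a decoration word and \<open>t\<close> is the least element of \<open>\<down>t\<close>, meets exist as well.
\<close>

subsection \<open>Preorder lists of paths\<close>

text \<open>Preorder on nodes is the lexicographic order of their paths, in which a proper prefix,
  that is an ancestor, comes first.\<close>

abbreviation path_less :: "(nat list \<times> nat list) set" where
  "path_less \<equiv> lexord less_than"

text \<open>A path after \<open>q\<close> that does not extend \<open>q\<close> comes after every
  extension of \<open>q\<close>, so \<open>r\<close> extends \<open>q\<close>; its next entry is
  below \<open>j\<close>, as \<open>r\<close> precedes \<open>q @ [j]\<close>.\<close>

lemma path_less_between:
  assumes "(q, r) \<in> path_less" "(r, q @ [j]) \<in> path_less"
  shows "\<exists>j' z. r = q @ j' # z \<and> j' < j"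
  using assms
proof (induction q arbitrary: r)
  case Nil
  then show ?case by (cases r) auto
next
  case (Cons a q)
  then show ?case by (cases r) auto
qed

lemma path_less_irrefl: "(q, q) \<notin> path_less"
  by (rule lexord_irreflexive) simp

lemma path_less_trans:
  "(q, r) \<in> path_less \<Longrightarrow> (r, z) \<in> path_less \<Longrightarrow> (q, z) \<in> path_less"
  by (rule lexord_trans) (auto intro: trans_less_than)

text \<open>Both heads are the least element of the common set. This recovers a node list from its
  set.\<close>

lemma sorted_wrt_set_unique:
  assumes trans: "\<And>x y z. R x y \<Longrightarrow> R y z \<Longrightarrow> R x z" and irrefl: "\<And>x. \<not> R x x"
    and "sorted_wrt R xs" "sorted_wrt R ys" "set xs = set ys"
  shows "xs = ys"
  using assms(3-)
proof (induction xs arbitrary: ys)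
  case Nil
  then show ?case by simp
next
  case (Cons x xs)
  then obtain y ys' where ys: "ys = y # ys'" by (cases ys) auto
  have "x = y \<or> R x y" "x = y \<or> R y x"
    using Cons.prems unfolding ys by auto
  then have eq: "x = y" using trans irrefl by blast
  have "x \<notin> set xs" "y \<notin> set ys'"
    using Cons.prems irrefl unfolding ys by auto
  then have "set xs = set ys'"
    using Cons.prems(3) eq unfolding ys by auto
  then show ?case using Cons eq unfolding ys by auto
qed

section \<open>Terms as sorted lists of path-decoration pairs\<close>

definition nodes :: "'s tm \<Rightarrow> (nat list \<times> 's) list" where
  "nodes t = zip (inodes t) (dc t)"

lemma map2_upt_eq:
  "map2 f [1..<Suc (length xs)] xs = map (\<lambda>k. f (Suc k) (xs ! k)) [0..<length xs]"
  by (rule nth_equalityI) (auto simp del: upt_Suc)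

text \<open>Indexing subterms by \<open>k\<close> from 0 gives \<open>inodes\<close> and
  \<open>dc\<close> the same block structure, so they can be zipped block by block.\<close>

lemma inodes_Node:
  "inodes (Node s ts) = [] # concat (map (\<lambda>k. map ((#) (Suc k)) (inodes (ts ! k))) [0..<length ts])"
proof -
  have "inodes (Node s ts) = [] # concat (map2 (\<lambda>j ps. map ((#) j) ps)
      [1..<Suc (length (map inodes ts))] (map inodes ts))"
    by simp
  also have "\<dots> = [] # concat (map (\<lambda>k. map ((#) (Suc k)) (inodes (ts ! k))) [0..<length ts])"
    unfolding map2_upt_eq by (auto intro!: arg_cong[where f = concat])
  finally show ?thesis .
qed

lemma dc_Node: "dc (Node s ts) = s # concat (map (\<lambda>k. dc (ts ! k)) [0..<length ts])"
  by (auto intro!: arg_cong[where f = concat] nth_equalityI)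

lemma length_inodes: "length (inodes t) = length (dc t)"
proof (induction t)
  case (Node s ts)
  then show ?case
    unfolding inodes_Node dc_Node by (auto simp: length_concat comp_def intro!: arg_cong[where f = sum_list])
qed simp

lemma zip_concat_map:
  assumes "\<And>k. k \<in> set ks \<Longrightarrow> length (f k) = length (g k)"
  shows "zip (concat (map f ks)) (concat (map g ks)) = concat (map (\<lambda>k. zip (f k) (g k)) ks)"
  using assms by (induction ks) auto

lemma nodes_Leaf: "nodes Leaf = []"
  by (simp add: nodes_def)

lemma nodes_Node:
  "nodes (Node s ts) = ([], s) #
     concat (map (\<lambda>k. map (apfst ((#) (Suc k))) (nodes (ts ! k))) [0..<length ts])"
  unfolding nodes_def inodes_Node dc_Node
  by (auto simp: zip_concat_map length_inodes zip_map1 apfst_def map_prod_def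
      intro!: arg_cong[where f = concat])

lemma set_nodes_Node:
  "set (nodes (Node s ts)) =
     insert ([], s) {(Suc k # q, s') |k q s'. k < length ts \<and> (q, s') \<in> set (nodes (ts ! k))}"
  unfolding nodes_Node by force

lemma map_snd_nodes: "map snd (nodes t) = dc t"
  by (simp add: nodes_def length_inodes)

lemma sorted_nodes: "sorted_wrt (\<lambda>x y. (fst x, fst y) \<in> path_less) (nodes t)"
proof (induction t)
  case Leaf
  then show ?case by (simp add: nodes_Leaf)
next
  case (Node s ts)
  have "sorted_wrt (\<lambda>x y. (fst x, fst y) \<in> path_less)
      (concat (map (\<lambda>k. map (apfst ((#) (Suc k))) (nodes (ts ! k))) [0..<m]))"
    if "m \<le> length ts" for m
    using that
  proof (induction m)
    case (Suc m)
    then show ?case using Node[OF nth_mem, of m]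
      by (auto simp: sorted_wrt_append sorted_wrt_map)
  qed simp
  then show ?case unfolding nodes_Node by (auto)
qed

text \<open>Leaves contribute no pair, so the number of children comes from the arity of the root
  decoration; the paths starting with \<open>Suc k\<close> then determine the subterm at index
  \<open>k\<close>.\<close>

lemma set_nodes_inj:
  assumes "t \<in> terms S ar" "u \<in> terms S ar" "set (nodes t) = set (nodes u)"
  shows "t = u"
  using assms
proof (induction arbitrary: u rule: terms.induct)
  case Leaf
  then show ?case by (cases u) (auto simp: nodes_Leaf nodes_Node)
next
  case (Node s ts)
  from Node.prems obtain us where u: "u = Node s us" "length us = ar s" "\<forall>v\<in>set us. v \<in> terms S ar"
    by (cases u) (auto simp: nodes_Leaf set_nodes_Node elim: terms.cases)
  have "ts ! k = us ! k" if k: "k < length ts" for k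
  proof -
    have "(q, r) \<in> set (nodes (ts ! k)) \<longleftrightarrow> (q, r) \<in> set (nodes (us ! k))" for q r
    proof -
      have "(Suc k # q, r) \<in> set (nodes (Node s ts)) \<longleftrightarrow> (Suc k # q, r) \<in> set (nodes (Node s us))"
        using Node.prems(2) u(1) by simp
      then show ?thesis using k u(2) Node.hyps(2) by (auto simp: set_nodes_Node)
    qed
    then have "set (nodes (ts ! k)) = set (nodes (us ! k))" by auto
    moreover have "us ! k \<in> terms S ar" using u k Node.hyps(2) by simp
    ultimately show ?thesis using Node.IH nth_mem[OF k] by blast
  qed
  then show ?case using u Node.hyps(2) by (auto intro: nth_equalityI)
qed

section \<open>Sets of pairs that are node sets of terms\<close>

definition closed_nodes :: "('s \<Rightarrow> nat) \<Rightarrow> (nat list \<times> 's) set \<Rightarrow> bool" where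
  "closed_nodes ar N \<longleftrightarrow>
     (\<forall>q j s. (q @ [j], s) \<in> N \<longrightarrow> (\<exists>s'. (q, s') \<in> N \<and> j \<in> {1..ar s'}))"

lemma closed_nodes_nodes:
  assumes "t \<in> terms S ar"
  shows "closed_nodes ar (set (nodes t))"
  using assms
proof induction
  case Leaf
  then show ?case by (simp add: nodes_Leaf closed_nodes_def)
next
  case (Node s ts)
  show ?case unfolding closed_nodes_def
  proof (intro allI impI)
    fix q j s' assume *: "(q @ [j], s') \<in> set (nodes (Node s ts))"
    show "\<exists>s'. (q, s') \<in> set (nodes (Node s ts)) \<and> j \<in> {1..ar s'}"
    proof (cases q)
      case Nil
      then show ?thesis using * Node.hyps by (auto simp: set_nodes_Node)
    next
      case (Cons a q')
      then obtain k where k: "a = Suc k" "k < length ts" "(q' @ [j], s') \<in> set (nodes (ts ! k))"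
        using * by (auto simp: set_nodes_Node)
      then obtain s'' where "(q', s'') \<in> set (nodes (ts ! k))" "j \<in> {1..ar s''}"
        using Node.IH nth_mem[OF k(2)] unfolding closed_nodes_def by blast
      then show ?thesis using Cons k by (auto simp: set_nodes_Node)
    qed
  qed
qed

lemma dc_subset: "t \<in> terms S ar \<Longrightarrow> set (dc t) \<subseteq> S"
  by (induction rule: terms.induct) auto

lemma closed_nodes_root:
  assumes "closed_nodes ar N" "(q, s) \<in> N"
  shows "\<exists>s'. ([], s') \<in> N"
  using assms(2)
proof (induction q arbitrary: s rule: rev_induct)
  case (snoc j q)
  then show ?case using assms(1) unfolding closed_nodes_def by blast
qed blast

text \<open>Induction on the number of nodes: the root is split off, and the paths through each
  child, with their first entry removed, form a smaller set of the same kind.\<close>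

lemma exists_term_of_nodes:
  assumes "finite N" "closed_nodes ar N" "snd ` N \<subseteq> S"
    "\<And>q s s'. (q, s) \<in> N \<Longrightarrow> (q, s') \<in> N \<Longrightarrow> s = s'"
  shows "\<exists>t\<in>terms S ar. set (nodes t) = N"
  using assms
proof (induction "card N" arbitrary: N rule: less_induct)
  case less
  show ?case
  proof (cases "N = {}")
    case True
    then show ?thesis by (intro bexI[of _ Leaf] terms.Leaf) (simp add: nodes_Leaf)
  next
    case False
    then obtain q r where "(q, r) \<in> N" by (metis all_not_in_conv surj_pair)
    then obtain s where root: "([], s) \<in> N"
      using closed_nodes_root[OF less.prems(2)] by blast
    define M where "M k = {(q, s'). (Suc k # q, s') \<in> N}" for k
    have "\<exists>u\<in>terms S ar. set (nodes u) = M k" for k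
    proof (rule less.hyps)
      have sub: "apfst ((#) (Suc k)) ` M k \<subset> N"
      proof
        show "apfst ((#) (Suc k)) ` M k \<subseteq> N" by (auto simp: M_def)
        have "([], s) \<notin> apfst ((#) (Suc k)) ` M k" by auto
        then show "apfst ((#) (Suc k)) ` M k \<noteq> N" using root by blast
      qed
      have inj: "inj_on (apfst ((#) (Suc k))) (M k)"
        by (auto simp: inj_on_def)
      show "card (M k) < card N"
        using psubset_card_mono[OF less.prems(1) sub] card_image[OF inj] by simp
      show "finite (M k)"
        by (rule finite_imageD[OF finite_subset[OF _ less.prems(1)] inj]) (use sub in blast)
      show "closed_nodes ar (M k)"
        unfolding closed_nodes_def
      proof (intro allI impI)
        fix q j s assume "(q @ [j], s) \<in> M k"
        then have "((Suc k # q) @ [j], s) \<in> N" by (simp add: M_def)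
        then obtain s' where "(Suc k # q, s') \<in> N" "j \<in> {1..ar s'}"
          using less.prems(2) unfolding closed_nodes_def by blast
        then show "\<exists>s'. (q, s') \<in> M k \<and> j \<in> {1..ar s'}" by (auto simp: M_def)
      qed
      show "snd ` M k \<subseteq> S"
      proof
        fix s assume "s \<in> snd ` M k"
        then obtain q where "(Suc k # q, s) \<in> N" by (auto simp: M_def)
        then show "s \<in> S" using less.prems(3) by force
      qed
      show "\<And>q s s'. (q, s) \<in> M k \<Longrightarrow> (q, s') \<in> M k \<Longrightarrow> s = s'"
        unfolding M_def mem_Collect_eq case_prod_conv by (rule less.prems(4))
    qed
    then obtain f where f: "\<And>k. f k \<in> terms S ar" "\<And>k. set (nodes (f k)) = M k"
      by metis
    let ?t = "Node s (map f [0..<ar s])"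
    have "?t \<in> terms S ar"
    proof (rule terms.Node)
      show "s \<in> S" using root less.prems(3) by force
    qed (auto simp: f(1))
    moreover have "set (nodes ?t) = N"
    proof -
      \<comment> \<open>Closure bounds the last entry of a path by an arity, so a path is first
        shortened to \<open>[a]\<close>, whose parent is the root.\<close>
      have *: "\<exists>k. a = Suc k \<and> k < ar s" if "(a # q, s') \<in> N" for a q s'
        using that
      proof (induction q arbitrary: s' rule: rev_induct)
        case Nil
        then have "([] @ [a], s') \<in> N" by simp
        then obtain r where "([], r) \<in> N" "a \<in> {1..ar r}"
          using less.prems(2) unfolding closed_nodes_def by blast
        moreover from this have "r = s" using less.prems(4) root by blast
        ultimately show ?case by (cases a) auto
      next
        case (snoc j q)
        then have "((a # q) @ [j], s') \<in> N" by simp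
        then obtain r where "(a # q, r) \<in> N"
          using less.prems(2) unfolding closed_nodes_def by blast
        then show ?case by (rule snoc.IH)
      qed
      have "(q, s') \<in> set (nodes ?t) \<longleftrightarrow> (q, s') \<in> N" for q s'
      proof (cases q)
        case Nil
        then show ?thesis using root less.prems(4)[OF root, of s'] by (auto simp: set_nodes_Node)
      next
        case (Cons a q')
        then show ?thesis using *[of a q' s'] by (auto simp: set_nodes_Node f(2) M_def)
      qed
      then show ?thesis by auto
    qed
    ultimately show ?thesis by blast
  qed
qed

subsection \<open>Connection words\<close>

text \<open>The letters \<open>slot a p 1 > \<dots> > slot a p a\<close> of a node \<open>p\<close> of arity \<open>a\<close> lie in the interval
  \<open>[p, p + 1)\<close>; the value \<open>j = 0\<close> occurs only in the conventional letter of the root.\<close>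

definition slot :: "nat \<Rightarrow> nat \<Rightarrow> nat \<Rightarrow> real" where
  "slot a p j = real p + 1 - 2 powi (int j - int a)"

lemma cnc_slot: "cnc ar t i = slot (ar (decoration t (pa t i))) (pa t i) (lp t i)"
  by (simp add: cnc_def slot_def)

text \<open>For \<open>j \<le> a\<close> the subtracted power lies in (0, 1], so the integer part of
  a letter is its node \<open>p\<close>.\<close>

lemma slot_bounds:
  assumes "j \<le> a"
  shows "real p \<le> slot a p j" "slot a p j < real p + 1"
  using power_int_increasing[of "int j - int a" 0 "2::real"] assms by (auto simp: slot_def)

lemma slot_less_iff: "slot a p j < slot a p j' \<longleftrightarrow> j' < j"
  using power_int_strict_increasing[of "int j - int a" "int j' - int a" "2::real"]
    power_int_strict_increasing[of "int j' - int a" "int j - int a" "2::real"]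
  by (cases j j' rule: linorder_cases) (auto simp: slot_def)

text \<open>The integer part gives the node, and strict monotonicity in \<open>j\<close> the child
  number. The arity is a function \<open>f\<close> of the node, so equal nodes have equal
  arities.\<close>

lemma slot_eqD:
  assumes "slot (f p) p j = slot (f p') p' j'" "j \<le> f p" "j' \<le> f p'"
  shows "p = p' \<and> j = j'"
proof -
  have "p = p'"
    using slot_bounds[of j "f p" p] slot_bounds[of j' "f p'" p'] assms by linarith
  moreover from this have "j = j'"
    using slot_less_iff[of "f p" p j j'] slot_less_iff[of "f p" p j' j] assms(1)
    by (cases j j' rule: linorder_cases) auto
  ultimately show ?thesis ..
qed

text \<open>The first letter is the conventional one of the root, with parent 1 and child number 0;
  the guard covers the empty word of \<open>Leaf\<close>.\<close>

definition connection_word :: "('s \<Rightarrow> nat) \<Rightarrow> 's list \<Rightarrow> (nat \<Rightarrow> real) \<Rightarrow> bool" where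
  "connection_word ar w c \<longleftrightarrow>
     (w \<noteq> [] \<longrightarrow> c 1 = slot (ar (w ! 0)) 1 0) \<and>
     (\<forall>i\<in>{2..length w}. \<exists>p\<in>{1..<i}. \<exists>j\<in>{1..ar (w ! (p - 1))}.
        c i = slot (ar (w ! (p - 1))) p j \<and> (\<forall>k\<in>{p<..<i}. c i < c k))"

text \<open>If \<open>c i\<close> attains the maximum, then \<open>c\<close> provides the parent, and its letters strictly
  between the parent and \<open>i\<close> can only grow.\<close>

lemma connection_word_max:
  assumes "connection_word ar w c" "connection_word ar w d"
  shows "connection_word ar w (\<lambda>i. max (c i) (d i))"
  unfolding connection_word_def
proof (intro conjI ballI impI)
  assume "w \<noteq> []"
  then show "max (c 1) (d 1) = slot (ar (w ! 0)) 1 0"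
    using assms by (simp add: connection_word_def)
next
  fix i assume i: "i \<in> {2..length w}"
  obtain e where e: "connection_word ar w e" "max (c i) (d i) = e i"
    "\<And>k. e k \<le> max (c k) (d k)"
    using assms by (cases "c i \<le> d i") (auto simp: max_def intro: that[of c] that[of d])
  then show "\<exists>p\<in>{1..<i}. \<exists>j\<in>{1..ar (w ! (p - 1))}.
      max (c i) (d i) = slot (ar (w ! (p - 1))) p j \<and>
      (\<forall>k\<in>{p<..<i}. max (c i) (d i) < max (c k) (d k))"
    using i unfolding connection_word_def e(2) by (meson less_le_trans)
qed

section \<open>Node numbers and parent edges\<close>

lemma length_dc: "length (dc t) = tdeg t"
  by (simp add: tdeg_def length_inodes)

lemma nodes_nth:
  assumes "i \<in> {1..tdeg t}"
  shows "nodes t ! (i - 1) = (inode t i, decoration t i)"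
  using assms by (auto simp: nodes_def inode_def decoration_def tdeg_def length_inodes)

lemma length_nodes: "length (nodes t) = tdeg t"
  by (simp add: nodes_def tdeg_def length_inodes)

lemma set_conv_nth_minus_1: "set xs = (\<lambda>i. xs ! (i - 1)) ` {1..length xs}"
proof (intro equalityI subsetI)
  fix x assume "x \<in> set xs"
  then obtain k where "k < length xs" "xs ! k = x" unfolding in_set_conv_nth by blast
  then show "x \<in> (\<lambda>i. xs ! (i - 1)) ` {1..length xs}"
    by (intro image_eqI[of _ _ "Suc k"]) auto
qed auto

lemma set_nodes: "set (nodes t) = (\<lambda>i. (inode t i, decoration t i)) ` {1..tdeg t}"
proof -
  have "set (nodes t) = (\<lambda>i. nodes t ! (i - 1)) ` {1..tdeg t}"
    unfolding set_conv_nth_minus_1 length_nodes ..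
  also have "\<dots> = (\<lambda>i. (inode t i, decoration t i)) ` {1..tdeg t}"
    by (intro image_cong refl nodes_nth)
  finally show ?thesis .
qed

lemma inode_less:
  assumes "i \<in> {1..tdeg t}" "k \<in> {1..tdeg t}" "i < k"
  shows "(inode t i, inode t k) \<in> path_less"
proof -
  have "(fst (nodes t ! (i - 1)), fst (nodes t ! (k - 1))) \<in> path_less"
    using sorted_wrt_nth_less[OF sorted_nodes, of "i - 1" "k - 1" t] assms
    by (auto simp: length_nodes)
  then show ?thesis using assms(1,2) by (simp only: nodes_nth fst_conv)
qed

lemma inode_less_iff:
  assumes "i \<in> {1..tdeg t}" "k \<in> {1..tdeg t}"
  shows "(inode t i, inode t k) \<in> path_less \<longleftrightarrow> i < k"
  using assms inode_less[of i t k] inode_less[of k t i] path_less_irrefl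
    path_less_trans[of "inode t i" "inode t k" "inode t i"]
  by (cases i k rule: linorder_cases) auto

lemma inode_inj:
  assumes "i \<in> {1..tdeg t}" "k \<in> {1..tdeg t}" "inode t i = inode t k"
  shows "i = k"
  using inode_less_iff[of i t k] inode_less_iff[of k t i] assms path_less_irrefl
  by (cases i k rule: linorder_cases) auto

text \<open>Distinct nodes have distinct paths, so the definite descriptions in \<open>pa\<close>
  and \<open>lp\<close> have a single candidate.\<close>

lemma pa_lp_eqI:
  assumes "i \<noteq> 1" "p \<in> {1..tdeg t}" "inode t i = inode t p @ [j]"
  shows "pa t i = p" "lp t i = j"
proof -
  show *: "pa t i = p"
    using assms inode_inj[OF _ assms(2)] by (auto simp: pa_def intro!: the_equality)
  show "lp t i = j"
    using assms unfolding lp_def * by auto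
qed

lemma pa_lp_1: "pa t 1 = 1" "lp t 1 = 0"
  by (simp_all add: pa_def lp_def)

lemma inode_1:
  assumes "1 \<le> tdeg t"
  shows "inode t 1 = []"
  using assms by (cases t) (simp_all add: inode_def tdeg_def)

text \<open>The path of a node other than the root is nonempty; dropping its last entry gives a
  node, by closure, and this prefix comes earlier in preorder.\<close>

lemma parent:
  assumes "t \<in> terms S ar" "i \<in> {2..tdeg t}"
  shows "pa t i \<in> {1..<i}" "lp t i \<in> {1..ar (decoration t (pa t i))}"
    "inode t i = inode t (pa t i) @ [lp t i]"
proof -
  have i: "i \<in> {1..tdeg t}" "1 \<in> {1..tdeg t}" using assms(2) by auto
  have "inode t i \<noteq> []"
    using inode_inj[OF i] inode_1[of t] assms(2) by auto
  then obtain q j where q: "inode t i = q @ [j]" by (metis rev_exhaust)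
  then have "(q @ [j], decoration t i) \<in> set (nodes t)"
    using i(1) unfolding set_nodes by (intro image_eqI[of _ _ i]) auto
  moreover have "closed_nodes ar (set (nodes t))" by (rule closed_nodes_nodes[OF assms(1)])
  ultimately obtain s where "(q, s) \<in> set (nodes t)" "j \<in> {1..ar s}"
    unfolding closed_nodes_def by blast
  then obtain p where p: "p \<in> {1..tdeg t}" "q = inode t p" "j \<in> {1..ar (decoration t p)}"
    by (auto simp: set_nodes)
  have "pa t i = p" "lp t i = j"
    using pa_lp_eqI[of i p t j] p q assms(2) by auto
  moreover have "p < i"
    using inode_less_iff[OF p(1) i(1)] p(2) q by (auto intro: lexord_append_rightI)
  ultimately show "pa t i \<in> {1..<i}" "lp t i \<in> {1..ar (decoration t (pa t i))}"
    "inode t i = inode t (pa t i) @ [lp t i]"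
    using p q by auto
qed

section \<open>Terms and their connection words\<close>

lemma cnc_1: "cnc ar t 1 = slot (ar (dc t ! 0)) 1 0"
  by (simp add: cnc_slot pa_lp_1[simplified] decoration_def)

text \<open>A node visited between the parent of \<open>i\<close> and \<open>i\<close> lies in the
  subtree at an earlier slot of that parent. It fills this slot itself or has a later parent; either
  way its letter is larger.\<close>

lemma connection_word_cnc:
  assumes t: "t \<in> terms S ar"
  shows "connection_word ar (dc t) (cnc ar t)"
  unfolding connection_word_def length_dc
proof (intro conjI ballI impI)
  show "cnc ar t 1 = slot (ar (dc t ! 0)) 1 0" by (rule cnc_1)
next
  fix i assume i: "i \<in> {2..tdeg t}"
  let ?p = "pa t i" and ?j = "lp t i"
  note pi = parent[OF t i]
  have "cnc ar t i < cnc ar t k" if k: "k \<in> {?p<..<i}" for k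
  proof -
    have k2: "k \<in> {2..tdeg t}" using k pi i by auto
    note pk = parent[OF t k2]
    have "(inode t ?p, inode t k) \<in> path_less" "(inode t k, inode t ?p @ [?j]) \<in> path_less"
      using inode_less[of ?p t k] inode_less[of k t i] k k2 i pi by auto
    then obtain j' z where z: "inode t k = inode t ?p @ j' # z" "j' < ?j"
      using path_less_between by blast
    show ?thesis
    proof (cases z rule: rev_cases)
      case Nil
      then have "pa t k = ?p" "lp t k = j'"
        using pa_lp_eqI[of k ?p t j'] k2 i pi z by auto
      then show ?thesis using z by (simp add: cnc_slot slot_less_iff)
    next
      case (snoc z' m)
      then have "inode t (pa t k) = inode t ?p @ j' # z'"
        using pk(3) z by simp
      then have "?p < pa t k"
        using inode_less_iff[of ?p t "pa t k"] k2 i pi(1) pk(1)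
        by (auto intro: lexord_append_rightI)
      moreover have "cnc ar t i < real ?p + 1" "real (pa t k) \<le> cnc ar t k"
        using pi(2) pk(2) by (auto simp: cnc_slot slot_bounds)
      ultimately show ?thesis by linarith
    qed
  qed
  then show "\<exists>p\<in>{1..<i}. \<exists>j\<in>{1..ar (dc t ! (p - 1))}.
      cnc ar t i = slot (ar (dc t ! (p - 1))) p j \<and> (\<forall>k\<in>{p<..<i}. cnc ar t i < cnc ar t k)"
    using pi unfolding cnc_slot[of ar t i] decoration_def by blast
qed

text \<open>Strong induction on the node number: a letter determines parent and child number, and
  the path of the parent, which has a smaller number, already agrees.\<close>

lemma cnc_inj:
  assumes t: "t \<in> terms S ar" and u: "u \<in> terms S ar" and dc: "dc t = dc u"
    and cnc: "\<forall>i\<in>{1..tdeg t}. cnc ar t i = cnc ar u i"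
  shows "t = u"
proof -
  have deg: "tdeg t = tdeg u" using dc by (metis length_dc)
  have deco: "decoration t i = decoration u i" for i by (simp add: decoration_def dc)
  have "inode t i = inode u i" if "i \<in> {1..tdeg t}" for i
    using that
  proof (induction i rule: less_induct)
    case (less i)
    show ?case
    proof (cases "i = 1")
      case True
      then show ?thesis using less.prems deg by (simp add: inode_1[simplified])
    next
      case False
      then have i: "i \<in> {2..tdeg t}" "i \<in> {2..tdeg u}" using less.prems deg by auto
      have "cnc ar t i = cnc ar u i" using cnc i by auto
      then have "pa t i = pa u i \<and> lp t i = lp u i"
        using parent[OF t i(1)] parent[OF u i(2)]
        by (intro slot_eqD[of "\<lambda>p. ar (decoration t p)"]) (auto simp: cnc_slot deco)
      then show ?thesis
        using parent[OF t i(1)] parent[OF u i(2)] less.IH[of "pa t i"] i by auto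
    qed
  qed
  then have "set (nodes t) = set (nodes u)"
    unfolding set_nodes deg[symmetric] deco by (intro image_cong) auto
  then show ?thesis using set_nodes_inj t u by blast
qed

text \<open>The paths \<open>P i\<close> are read off \<open>c\<close> by recursion. The fact \<open>below\<close> says that all nodes between
  the parent of \<open>i\<close> and \<open>i\<close> lie in subtrees to the left of \<open>i\<close>, so that the paths come in preorder.\<close>

lemma exists_term_of_connection_word:
  assumes c: "connection_word ar w c" and w: "set w \<subseteq> S"
  shows "\<exists>t\<in>terms S ar. dc t = w \<and> (\<forall>i\<in>{1..length w}. cnc ar t i = c i)"
proof -
  define n where "n = length w"
  define d where "d p = w ! (p - 1)" for p
  obtain p j where pj: "\<And>i. i \<in> {2..n} \<Longrightarrow> p i \<in> {1..<i} \<and> j i \<in> {1..ar (d (p i))} \<and>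
      c i = slot (ar (d (p i))) (p i) (j i) \<and> (\<forall>k\<in>{p i<..<i}. c i < c k)"
    using c unfolding connection_word_def n_def d_def by metis
  \<comment> \<open>The default \<open>[]\<close> is the path of the root, \<open>i = 1\<close>; the
    recursion is well-founded because \<open>p i < i\<close>.\<close>
  define F where "F P i = (if i \<in> {2..n} then P (p i) @ [j i] else [])" for P :: "nat \<Rightarrow> nat list" and i
  define P where "P = wfrec less_than F"
  have P: "P i = (if i \<in> {2..n} then P (p i) @ [j i] else [])" for i
  proof -
    have "P i = F (cut P less_than i) i" unfolding P_def by (rule wfrec) simp
    then show ?thesis using pj[of i] by (auto simp: F_def cut_apply)
  qed
  have below: "\<exists>j' z. P k = P (p i) @ j' # z \<and> j' < j i" if i: "i \<in> {2..n}" "k \<in> {p i<..<i}" for i k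
    using i(2)
  proof (induction k rule: less_induct)
    case (less k)
    have k: "k \<in> {2..n}" using less.prems i pj[of i] by auto
    have ck: "c i < c k" using pj i less.prems by blast
    \<comment> \<open>Comparing integer parts gives \<open>p i \<le> p k\<close>. If they are equal,
      the larger letter has the smaller child number; otherwise \<open>p k\<close> is in the same
      range and \<open>k\<close> inherits its prefix.\<close>
    have "real (p i) \<le> c i" "c k < real (p k) + 1"
      using pj[OF i(1)] pj[OF k] slot_bounds by auto
    then have le: "p i \<le> p k" using ck by linarith
    show ?case
    proof (cases "p k = p i")
      case True
      then show ?thesis using P[of k] k ck pj[OF i(1)] pj[OF k] by (auto simp: slot_less_iff)
    next
      case False
      then have "p k \<in> {p i<..<i}" "p k < k" using le pj[OF k] less.prems by auto
      then obtain j' z where "P (p k) = P (p i) @ j' # z" "j' < j i"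
        using less.IH by blast
      then show ?thesis using P[of k] k by auto
    qed
  qed
  \<comment> \<open>Consecutive comparisons suffice by transitivity: either \<open>i\<close> is the
    parent of \<open>Suc i\<close>, or \<open>below\<close> places it further left.\<close>
  have step: "(P i, P (Suc i)) \<in> path_less" if i: "i \<in> {1..<n}" for i
  proof -
    have i': "Suc i \<in> {2..n}" using i by auto
    then have PS: "P (Suc i) = P (p (Suc i)) @ [j (Suc i)]" using P[of "Suc i"] by simp
    show ?thesis
    proof (cases "p (Suc i) = i")
      case True
      then show ?thesis unfolding PS by (auto intro: lexord_append_rightI)
    next
      case False
      then have "i \<in> {p (Suc i)<..<Suc i}" using pj[OF i'] by auto
      then obtain j' z where "P i = P (p (Suc i)) @ j' # z" "j' < j (Suc i)"
        using below[OF i'] by blast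
      then show ?thesis unfolding PS by (auto intro: lexord_append_leftI)
    qed
  qed
  define L where "L = map (\<lambda>i. (P (Suc i), w ! i)) [0..<n]"
  have sorted: "sorted_wrt (\<lambda>x y. (fst x, fst y) \<in> path_less) L"
    unfolding L_def
    by (subst sorted_wrt_iff_nth_Suc_transp) (auto intro!: transpI step dest: path_less_trans)
  have functional: "s = s'" if L: "(q, s) \<in> set L" "(q, s') \<in> set L" for q s s'
  proof -
    obtain i k where ik: "i < length L" "k < length L" "L ! i = (q, s)" "L ! k = (q, s')"
      using L unfolding in_set_conv_nth by blast
    then have "i = k"
      using sorted_wrt_nth_less[OF sorted, of i k] sorted_wrt_nth_less[OF sorted, of k i]
        path_less_irrefl by (cases i k rule: linorder_cases) auto
    then show ?thesis using ik by simp
  qed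
  have setL: "set L = (\<lambda>i. (P i, d i)) ` {1..n}"
    unfolding set_conv_nth_minus_1[of L] by (intro image_cong) (auto simp: L_def d_def)
  have "closed_nodes ar (set L)"
    unfolding closed_nodes_def
  proof (intro allI impI)
    fix q m s assume "(q @ [m], s) \<in> set L"
    then obtain i where i: "i \<in> {1..n}" "P i = q @ [m]" by (auto simp: setL)
    then have i2: "i \<in> {2..n}" using P[of i] by (auto split: if_splits)
    then have "P (p i) = q" "j i = m" using P[of i] i by auto
    then show "\<exists>s'. (q, s') \<in> set L \<and> m \<in> {1..ar s'}"
      using pj[OF i2] i2 unfolding setL by (intro exI[of _ "d (p i)"]) auto
  qed
  moreover have "snd ` set L \<subseteq> S"
    using w by (auto simp: L_def n_def)
  ultimately obtain t where t: "t \<in> terms S ar" "set (nodes t) = set L"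
    using exists_term_of_nodes[of "set L" ar S] functional by auto
  \<comment> \<open>Only the set of pairs of \<open>t\<close> is known so far; sortedness fixes
    their order and hence the decoration word.\<close>
  then have nodes: "nodes t = L"
    by (intro sorted_wrt_set_unique[OF _ _ sorted_nodes sorted])
      (auto simp: path_less_irrefl intro: path_less_trans)
  have "dc t = map snd L" using map_snd_nodes[of t] nodes by simp
  then have dc: "dc t = w" by (simp add: L_def n_def comp_def map_nth)
  then have deg: "tdeg t = n" using length_dc[of t] by (simp add: n_def)
  have inode: "inode t i = P i" if "i \<in> {1..n}" for i
    using nodes_nth[of i t] that unfolding nodes deg by (auto simp: L_def)
  have deco: "decoration t i = d i" for i by (simp add: decoration_def d_def dc)
  have "cnc ar t i = c i" if i: "i \<in> {1..n}" for i
  proof (cases "i = 1")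
    case True
    then show ?thesis using c i cnc_1[of ar t] dc by (auto simp: connection_word_def n_def)
  next
    case False
    then have i2: "i \<in> {2..n}" using i by auto
    have "pa t i = p i \<and> lp t i = j i"
      using pa_lp_eqI[of i "p i" t "j i"] inode[OF i] inode[of "p i"] P[of i] i2 pj[OF i2]
      unfolding deg by auto
    then show ?thesis using pj[OF i2] by (simp add: cnc_slot deco)
  qed
  then show ?thesis using t dc n_def by auto
qed

subsection \<open>The lattice\<close>

text \<open>A term with a given decoration word is determined by its connection word, whose letters
  come from a finite set of slots.\<close>

lemma finite_terms_dc: "finite {t \<in> terms S ar. dc t = w}"
proof -
  \<comment> \<open>The child numbers start at 0 to include the conventional letter of the
    root.\<close>
  define V where "V = (\<Union>p\<in>{1..length w}. slot (ar (w ! (p - 1))) p ` {..ar (w ! (p - 1))})"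
  let ?f = "\<lambda>t. map (cnc ar t) [1..<Suc (length w)]"
  have "cnc ar t i \<in> V" if t: "t \<in> terms S ar" "dc t = w" and i: "i \<in> {1..length w}" for t i
  proof -
    have "pa t i \<in> {1..length w} \<and> lp t i \<le> ar (decoration t (pa t i))"
    proof (cases "i = 1")
      case True
      then show ?thesis using i by (simp add: pa_lp_1[simplified])
    next
      case False
      then have "i \<in> {2..tdeg t}" using i t(2) length_dc[of t] by auto
      then show ?thesis using parent[OF t(1)] i by fastforce
    qed
    then have p: "pa t i \<in> {1..length w}" and j: "lp t i \<le> ar (decoration t (pa t i))"
      by auto
    show ?thesis
      unfolding V_def using p j t(2)
      by (auto simp: cnc_slot decoration_def intro!: bexI[of _ "pa t i"])
  qed
  then have "?f ` {t \<in> terms S ar. dc t = w} \<subseteq> {xs. set xs \<subseteq> V \<and> length xs = length w}"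
    by (auto simp del: upt_Suc)
  moreover have "finite {xs. set xs \<subseteq> V \<and> length xs = length w}"
    by (rule finite_lists_length_eq) (simp add: V_def)
  ultimately have "finite (?f ` {t \<in> terms S ar. dc t = w})" by (rule finite_subset)
  moreover have "inj_on ?f {t \<in> terms S ar. dc t = w}"
  proof (rule inj_onI)
    fix t u assume tu: "t \<in> {t \<in> terms S ar. dc t = w}" "u \<in> {t \<in> terms S ar. dc t = w}" "?f t = ?f u"
    then have "\<forall>i\<in>{1..tdeg t}. cnc ar t i = cnc ar u i"
      using length_dc[of t] by (auto simp del: upt_Suc)
    then show "t = u" using tu by (intro cnc_inj[of t S ar u]) auto
  qed
  ultimately show ?thesis by (rule finite_imageD)
qed

text \<open>The meet of \<open>x\<close> and \<open>y\<close> is the join of their lower bounds: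
  this set is finite and contains \<open>b\<close>, and its join lies below \<open>x\<close> and
  \<open>y\<close>, which bound the set from above.\<close>

lemma lattice_if_finite_bottom_joins:
  fixes L (structure)
  assumes "partial_order L" "finite (carrier L)"
    and bot: "b \<in> carrier L" "\<And>x. x \<in> carrier L \<Longrightarrow> b \<sqsubseteq> x"
    and joins: "\<And>x y. x \<in> carrier L \<Longrightarrow> y \<in> carrier L \<Longrightarrow> \<exists>s. least L s (Upper L {x, y})"
  shows "lattice L"
proof -
  interpret partial_order L by fact
  interpret upper_semilattice L
    by unfold_locales (rule joins)
  show ?thesis
  proof unfold_locales
    fix x y assume xy: "x \<in> carrier L" "y \<in> carrier L"
    let ?A = "Lower L {x, y}"
    have "?A \<subseteq> carrier L" "b \<in> ?A" using xy bot by (auto intro: Lower_memI)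
    then have "least L (\<Squnion>?A) (Upper L ?A)"
      using assms(2) by (intro finite_sup_least) (auto intro: finite_subset)
    then have "greatest L (\<Squnion>?A) ?A"
      using xy unfolding least_def greatest_def
      by (auto simp: Upper_def Lower_def)
    then show "\<exists>s. greatest L s ?A" ..
  qed
qed

lemma down_order_simps [simp]:
  "carrier (down_order S ar t) = down S ar t"
  "eq (down_order S ar t) = (=)"
  "x \<sqsubseteq>\<^bsub>down_order S ar t\<^esub> y \<longleftrightarrow> ew_le ar x y"
  by (simp_all add: down_order_def)

lemma ew_le_antisym:
  "t \<in> terms S ar \<Longrightarrow> u \<in> terms S ar \<Longrightarrow> ew_le ar t u \<Longrightarrow> ew_le ar u t \<Longrightarrow> t = u"
  by (rule cnc_inj) (auto simp: ew_le_def length_dc[symmetric] intro: antisym)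

lemma ew_le_trans: "ew_le ar t u \<Longrightarrow> ew_le ar u v \<Longrightarrow> ew_le ar t v"
  by (force simp: ew_le_def length_dc[symmetric])

lemma partial_order_down: "partial_order (down_order S ar t)"
  by unfold_locales
    (auto simp: down_def ew_le_def[of ar x x for x] dest: ew_le_antisym ew_le_trans)

lemma is_vee_ex1:
  assumes "t1 \<in> down S ar t" "t2 \<in> down S ar t"
  shows "\<exists>!u. is_vee S ar t t1 t2 u"
proof -
  have t: "t1 \<in> terms S ar" "t2 \<in> terms S ar" "dc t1 = dc t" "dc t2 = dc t"
    using assms by (auto simp: down_def ew_le_def)
  then have "connection_word ar (dc t) (\<lambda>i. max (cnc ar t1 i) (cnc ar t2 i))"
    using connection_word_cnc[OF t(1)] connection_word_cnc[OF t(2)] by (simp add: connection_word_max)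
  moreover have "set (dc t) \<subseteq> S" using dc_subset[OF t(1)] t by simp
  ultimately obtain u where "is_vee S ar t t1 t2 u"
    using exists_term_of_connection_word unfolding is_vee_def length_dc[symmetric] by blast
  moreover have "u = u'" if "is_vee S ar t t1 t2 u" "is_vee S ar t t1 t2 u'" for u u'
    using that by (intro cnc_inj[of u S ar u']) (simp_all add: is_vee_def flip: length_dc)
  ultimately show ?thesis by blast
qed

lemma is_vee_least:
  assumes t12: "t1 \<in> down S ar t" "t2 \<in> down S ar t" and u: "is_vee S ar t t1 t2 u"
  shows "least (down_order S ar t) u (Upper (down_order S ar t) {t1, t2})"
proof -
  have "ew_le ar t u" "ew_le ar t1 u" "ew_le ar t2 u"
    using assms by (auto simp: down_def ew_le_def is_vee_def length_dc[symmetric] le_max_iff_disj)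
  moreover have "ew_le ar u v" if "ew_le ar t1 v" "ew_le ar t2 v" for v
    using that assms by (auto simp: down_def ew_le_def is_vee_def length_dc[symmetric])
  ultimately show ?thesis
    using u t12 by (auto simp: least_def Upper_def down_def is_vee_def)
qed

theorem theorem3p2p3:
  fixes S :: "'s set" and ar :: "'s \<Rightarrow> nat" and t :: "'s tm"
  assumes "t \<in> terms S ar"
  shows "lattice (down_order S ar t)
    \<and> (\<forall>t1\<in>down S ar t. \<forall>t2\<in>down S ar t.
         (\<exists>!u. is_vee S ar t t1 t2 u)
         \<and> vee S ar t t1 t2 \<in> down S ar t
         \<and> t1 \<squnion>\<^bsub>down_order S ar t\<^esub> t2 = vee S ar t t1 t2)"
proof -
  let ?L = "down_order S ar t"
  interpret partial_order ?L by (rule partial_order_down)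
  have least_vee: "least ?L (vee S ar t t1 t2) (Upper ?L {t1, t2})"
    if "t1 \<in> down S ar t" "t2 \<in> down S ar t" for t1 t2
    unfolding vee_def by (rule is_vee_least[OF that theI'[OF is_vee_ex1[OF that]]])
  have "finite (down S ar t)"
    by (rule finite_subset[OF _ finite_terms_dc[of S ar "dc t"]]) (auto simp: down_def ew_le_def)
  then have lattice: "lattice ?L"
    using assms least_vee
    by (intro lattice_if_finite_bottom_joins[of _ t] partial_order_down)
      (auto simp: down_def ew_le_def[of ar t t])
  moreover have "t1 \<squnion>\<^bsub>?L\<^esub> t2 = vee S ar t t1 t2"
    if "t1 \<in> down S ar t" "t2 \<in> down S ar t" for t1 t2
  proof -
    interpret lattice ?L by (rule lattice)
    \<comment> \<open>Both sides are least upper bounds of the same pair, and least elements are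
      unique in a partial order.\<close>
    show ?thesis
      using least_vee[OF that] sup_of_two_least[of t1 t2] that least_unique
      unfolding join_def by auto
  qed
  moreover have "vee S ar t t1 t2 \<in> down S ar t"
    if "t1 \<in> down S ar t" "t2 \<in> down S ar t" for t1 t2
    using least_closed[OF least_vee[OF that]] by simp
  ultimately show ?thesis by (intro conjI ballI is_vee_ex1)
qed

end
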